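(* Let $(a_n)_{n\ge0}$ be the sequence, listed in increasing order, of the non-negative integers $m$ such that $840m+169$ is a perfect square. Define $t(n)=0$ if $n\equiv 0,1,2,4,11,13,14,15 \pmod{16}$ and $t(n)=1$ otherwise. Then $$\sum_{n=0}^\infty(-1)^{t(n)}q^{a_n}=\frac{(q^3,q^4,q^7;q^7)_\infty}{(q^2,q^3;q^5)_\infty}.$$
   Context: Here $q$ is a complex number with $|q|<1$ (equivalently, the identity may be read as an identity of formal power series in $q$). For a complex number $a$, $(a;q)_\infty:=\prod_{i=0}^\infty(1-aq^i)$, and $(a_1,a_2,\dots,a_m;q)_\infty:=\prod_{j=1}^m(a_j;q)_\infty$. *)

theory Defs
  imports "HOL-Analysis.Analysis"
begin

definition qpoch_inf :: "complex \<Rightarrow> complex \<Rightarrow> complex" where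
  "qpoch_inf a q = (\<Prod>i. 1 - a * q ^ i)"

definition qpoch_inf_list :: "complex list \<Rightarrow> complex \<Rightarrow> complex" where
  "qpoch_inf_list as q = (\<Prod>a\<leftarrow>as. qpoch_inf a q)"

definition square_indices :: "nat set" where
  "square_indices = {m. \<exists>k::nat. 840 * m + 169 = k ^ 2}"

definition a_seq :: "nat \<Rightarrow> nat" where
  "a_seq n = enumerate square_indices n"

definition t_exp :: "nat \<Rightarrow> nat" where
  "t_exp n = (if n mod 16 \<in> {0, 1, 2, 4, 11, 13, 14, 15} then 0 else 1)"

text \<open>
  The next two lemmas show that the definitions above are meaningful: the infinite product
  converges for \<open>\<bar>q\<bar> < 1\<close>, and the enumerated set is infinite, so that \<^const>\<open>enumerate\<close>
  lists it completely and in increasing order.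
\<close>

lemma qpoch_inf_has_prod:
  assumes "norm q < 1"
  shows "(\<lambda>i. 1 - a * q ^ i) has_prod qpoch_inf a q"
proof -
  have "summable (\<lambda>i. norm a * norm q ^ i)"
    using assms by (intro summable_mult summable_geometric) simp
  then have "summable (\<lambda>i. norm ((1 - a * q ^ i) - 1))"
    by (simp add: norm_mult norm_power)
  then have "convergent_prod (\<lambda>i. 1 - a * q ^ i)"
    by (intro abs_convergent_prod_imp_convergent_prod summable_imp_abs_convergent_prod)
  then show ?thesis
    unfolding qpoch_inf_def by (rule convergent_prod_has_prod)
qed

lemma infinite_square_indices: "infinite square_indices"
proof -
  have "range (\<lambda>j::nat. 840 * j ^ 2 + 26 * j) \<subseteq> square_indices"
  proof clarify
    fix j :: nat
    have "840 * (840 * j ^ 2 + 26 * j) + 169 = (840 * j + 13) ^ 2"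
      by (simp add: power2_eq_square algebra_simps)
    then show "840 * j ^ 2 + 26 * j \<in> square_indices"
      unfolding square_indices_def by blast
  qed
  moreover have "strict_mono (\<lambda>j::nat. 840 * j ^ 2 + 26 * j)"
    by (intro strict_monoI add_le_less_mono) (simp_all add: power_mono)
  then have "infinite (range (\<lambda>j::nat. 840 * j ^ 2 + 26 * j))"
    using strict_mono_imp_inj_on range_inj_infinite by blast
  ultimately show ?thesis
    using finite_subset by blast
qed

end

theory Submission
  imports Defs
begin

text \<open>
  Since \<open>(q, q\<^sup>2, q\<^sup>3, q\<^sup>4, q\<^sup>5; q\<^sup>5) = (q; q)\<close>, the claim says that \<open>(q; q)\<close> times the series equals
  \<open>(q, q\<^sup>4, q\<^sup>5; q\<^sup>5) (q\<^sup>3, q\<^sup>4, q\<^sup>7; q\<^sup>7)\<close>. By the Jacobi triple product both sides are sums over two integers.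
  With \<open>k\<close> a square root of \<open>840 m + 169\<close> and \<open>l = \<plusminus>(6 n + 1)\<close> a square root of \<open>24 p + 1\<close>, \<open>p\<close> a pentagonal
  number, the left side becomes a signed sum of \<open>q\<close> to the power \<open>(k\<^sup>2 + 35 l\<^sup>2 - 204) / 840\<close> over odd \<open>k\<close>, \<open>l\<close>
  with \<open>3 | k - l\<close>, \<open>k\<close> prime to \<open>3\<close>, and fixed residues modulo \<open>5\<close> and (up to sign) \<open>7\<close>. The terms with
  \<open>3 | k\<close> may be added, because \<open>l \<mapsto> -l\<close> cancels them; then the terms in which \<open>4\<close> does not divide \<open>k - l\<close>
  may be dropped, because on writing \<open>k = l + 6 c\<close> the form is \<open>36 (l\<^sup>2 + c\<^sup>2) + 12 l c\<close>
  and exchanging \<open>l\<close> with \<open>c\<close> reverses the sign.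
  The substitution \<open>k = (7 x + 5 y) / 2\<close>, \<open>l = (x - y) / 2\<close> turns what remains into the product of the
  theta series modulo \<open>5\<close> and \<open>7\<close>, because then \<open>k\<^sup>2 + 35 l\<^sup>2 = 21 x\<^sup>2 + 15 y\<^sup>2\<close>.
\<close>

subsection \<open>The Jacobi triple product\<close>

definition tri :: "int \<Rightarrow> nat" where
  "tri j = nat (j * (j + 1) div 2)"

lemma int_tri: "2 * int (tri j) = j * (j + 1)"
proof -
  have "even (j * (j + 1))" by simp
  moreover have "j * (j + 1) \<ge> 0" by (cases "j \<ge> 0") (auto intro: mult_nonpos_nonpos)
  ultimately show ?thesis by (simp add: tri_def)
qed

lemma tri_minus: "tri (- j) = tri (j - 1)"
  by (simp add: tri_def algebra_simps)

lemma tri_eqI: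
  assumes "2 * int n = j * (j + 1)"
  shows "tri j = n"
  using int_tri[of j] assms by linarith

text \<open>The general term of Ramanujan's theta function \<open>f(-a, -b)\<close>. In this
  symmetric form, exchanging \<open>a\<close> with \<open>b\<close> amounts to
  \<open>j \<mapsto> -j\<close>, and both exponents are natural numbers for every integer
  \<open>j\<close>.\<close>

definition theta_term :: "complex \<Rightarrow> complex \<Rightarrow> int \<Rightarrow> complex" where
  "theta_term a b j = (if even j then 1 else -1) * a ^ tri j * b ^ tri (j - 1)"

lemma theta_term_minus: "theta_term a b (- j) = theta_term b a j"
  using tri_minus[of j] tri_minus[of "j + 1"] by (simp add: theta_term_def)

text \<open>Formally, consecutive terms have ratio \<open>- a * (a * b) ^ j\<close>. Multiplying by
  a power of \<open>a * b\<close> of order at least \<open>j\<close> keeps all exponents natural,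
  also for negative \<open>j\<close>.\<close>

lemma theta_term_shift_up:
  assumes "j \<le> int n"
  shows "a * (a * b) ^ n * theta_term a b j = - ((a * b) ^ nat (int n - j) * theta_term a b (j + 1))"
proof (cases "j \<ge> 0")
  case True
  then obtain m where j: "j = int m" using nonneg_int_cases by blast
  have n: "n = nat (int n - j) + m" using assms j by linarith
  have 1: "tri (j + 1) = tri j + (m + 1)"
    using int_tri[of j] by (intro tri_eqI) (simp add: j algebra_simps)
  have 2: "tri j = tri (j - 1) + m"
    using int_tri[of "j - 1"] by (intro tri_eqI) (simp add: j algebra_simps)
  have "theta_term a b (j + 1) = - (a * (a * b) ^ m * theta_term a b j)"
    unfolding theta_term_def using 1 2
    by (simp add: power_add power_mult_distrib)
  moreover have "(a * b) ^ n = (a * b) ^ nat (int n - j) * (a * b) ^ m"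
    by (subst n) (simp add: power_add)
  ultimately show ?thesis by simp
next
  case False
  then obtain m where j: "j = - int (Suc m)"
    using int_cases3[of j] by (metis Suc_pred not_le of_nat_0_le_iff order_refl)
  have n: "nat (int n - j) = n + Suc m" using j by linarith
  have 1: "tri j = tri (j + 1) + m"
    using int_tri[of "j + 1"] by (intro tri_eqI) (simp add: j algebra_simps)
  have 2: "tri (j - 1) = tri j + Suc m"
    using int_tri[of j] by (intro tri_eqI) (simp add: j algebra_simps)
  have "a * theta_term a b j = - ((a * b) ^ Suc m * theta_term a b (j + 1))"
    unfolding theta_term_def 2 using 1
    by (simp add: power_add power_mult_distrib)
  from arg_cong[OF this, of "\<lambda>y. (a * b) ^ n * y"] show ?thesis
    unfolding n by (simp add: power_add mult_ac)
qed

lemma theta_term_shift_down: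
  assumes "- j \<le> int n"
  shows "b * (a * b) ^ n * theta_term a b j = - ((a * b) ^ nat (int n + j) * theta_term a b (j - 1))"
  using theta_term_shift_up[OF assms, of b a] theta_term_minus[of b a j] theta_term_minus[of b a "j - 1"]
  by (simp add: mult.commute)

section \<open>Gaussian binomials and the finite triple product\<close>

definition qfact :: "complex \<Rightarrow> nat \<Rightarrow> complex" where
  "qfact x n = (\<Prod>i<n. 1 - x ^ Suc i)"

lemma qfact_0 [simp]: "qfact x 0 = 1"
  and qfact_Suc: "qfact x (Suc n) = qfact x n * (1 - x ^ Suc n)"
  by (simp_all add: qfact_def)

lemma one_minus_power_nonzero:
  assumes "norm (x :: complex) < 1"
  shows "1 - x ^ Suc n \<noteq> 0"
proof
  assume "1 - x ^ Suc n = 0"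
  then have "norm (x ^ Suc n) = 1" by simp
  moreover have "norm (x ^ Suc n) < 1"
    using assms power_less_one_iff[of "norm x" "Suc n"] unfolding norm_power by simp
  ultimately show False by simp
qed

text \<open>The value 0 at negative arguments makes binomials vanish outside their range and lets
  the recurrence \<open>inv_qfact_pred\<close> hold at \<open>m = 0\<close> too.\<close>

definition inv_qfact :: "complex \<Rightarrow> int \<Rightarrow> complex" where
  "inv_qfact x m = (if m < 0 then 0 else 1 / qfact x (nat m))"

lemma inv_qfact_pred:
  assumes "norm x < 1"
  shows "inv_qfact x (int m - 1) = (1 - x ^ m) * inv_qfact x (int m)"
proof (cases m)
  case (Suc k)
  then show ?thesis
    using one_minus_power_nonzero[OF assms, of k]
    by (simp add: inv_qfact_def qfact_Suc nat_add_distrib)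
qed (simp add: inv_qfact_def)

text \<open>The Gaussian binomial coefficient with parameters \<open>2 n\<close> and \<open>n + j\<close>.\<close>

definition central_qbinom :: "complex \<Rightarrow> nat \<Rightarrow> int \<Rightarrow> complex" where
  "central_qbinom x n j = qfact x (2 * n) * inv_qfact x (int n - j) * inv_qfact x (int n + j)"

lemma central_qbinom_eq_0: "\<bar>j\<bar> > int n \<Longrightarrow> central_qbinom x n j = 0"
  by (auto simp: central_qbinom_def inv_qfact_def)

text \<open>This is the q-Pascal rule used twice, leading from row \<open>2 n + 2\<close> to row
  \<open>2 n\<close>.\<close>

lemma central_qbinom_Suc:
  assumes x: "norm x < 1"
  assumes j: "\<bar>j\<bar> \<le> int n + 1"
  shows "central_qbinom x (Suc n) j =
    (1 + x ^ (2 * n + 1)) * central_qbinom x n j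
    + x ^ nat (int n - j + 1) * central_qbinom x n (j - 1)
    + x ^ nat (int n + j + 1) * central_qbinom x n (j + 1)"
proof -
  define u v where "u = nat (int n + 1 - j)" and "v = nat (int n + 1 + j)"
  have uv: "int u = int n + 1 - j" "int v = int n + 1 + j" "u + v = 2 * n + 2"
    using j by (auto simp: u_def v_def)
  let ?g = "inv_qfact x"
  have e: "int n - j = int u - 1" "int n + j = int v - 1" "int n - (j - 1) = int u"
    "int n + (j - 1) = int v - 2" "int n - (j + 1) = int u - 2" "int n + (j + 1) = int v"
    "int (Suc n) - j = int u" "int (Suc n) + j = int v"
    "nat (int u - 1 + 1) = u" "nat (int v - 1 + 1) = v"
    using uv by linarith+
  have q: "qfact x (2 * Suc n) = qfact x (2 * n) * (1 - x ^ (2 * n + 1)) * (1 - x ^ (2 * n + 2))"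
    by (simp add: qfact_Suc)
  have "(1 - x ^ (2 * n + 1)) * (1 - x ^ (2 * n + 2)) * ?g u * ?g v =
    (1 + x ^ (2 * n + 1)) * ?g (int u - 1) * ?g (int v - 1)
    + x ^ u * ?g u * ?g (int v - 2) + x ^ v * ?g (int u - 2) * ?g v" (is "?L = ?R")
  proof -
    \<comment> \<open>\<open>u = 0\<close> and \<open>v = 0\<close> are the outermost indices
      \<open>j = n + 1\<close> and \<open>j = -(n + 1)\<close>. Elsewhere every reciprocal is a
      polynomial multiple of \<open>?g u * ?g v\<close>, and a polynomial identity remains.\<close>
    consider "u = 0" | "v = 0" | "u > 0" "v > 0" by auto
    then show ?thesis
    proof cases
      case 1
      then have v: "v = Suc (Suc (2 * n))" using uv by linarith
      have "?g (int v - 1) = (1 - x ^ v) * ?g v" "?g (int v - 2) = (1 - x ^ (2 * n + 1)) * ?g (int v - 1)"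
        using inv_qfact_pred[OF x, of v] inv_qfact_pred[OF x, of "2 * n + 1"] v by (simp_all add: algebra_simps)
      moreover have "?g (int u - 1) = 0" "?g (int u - 2) = 0" using 1 by (auto simp: inv_qfact_def)
      ultimately show ?thesis using 1 v by simp
    next
      case 2
      then have u: "u = Suc (Suc (2 * n))" using uv by linarith
      have "?g (int u - 1) = (1 - x ^ u) * ?g u" "?g (int u - 2) = (1 - x ^ (2 * n + 1)) * ?g (int u - 1)"
        using inv_qfact_pred[OF x, of u] inv_qfact_pred[OF x, of "2 * n + 1"] u by (simp_all add: algebra_simps)
      moreover have "?g (int v - 1) = 0" "?g (int v - 2) = 0" using 2 by (auto simp: inv_qfact_def)
      ultimately show ?thesis using 2 u by simp
    next
      case 3
      then obtain u' v' where s: "u = Suc u'" "v = Suc v'" using gr0_conv_Suc by auto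
      have n: "2 * n = u' + v'" using uv s by linarith
      have g: "?g (int u - 1) = (1 - x ^ u) * ?g u" "?g (int u - 2) = (1 - x ^ u') * ?g (int u - 1)"
        "?g (int v - 1) = (1 - x ^ v) * ?g v" "?g (int v - 2) = (1 - x ^ v') * ?g (int v - 1)"
        using inv_qfact_pred[OF x, of u] inv_qfact_pred[OF x, of u']
          inv_qfact_pred[OF x, of v] inv_qfact_pred[OF x, of v'] s by (simp_all add: algebra_simps)
      have pw: "x ^ u = x * x ^ u'" "x ^ v = x * x ^ v'"
        "x ^ (2 * n + 1) = x * x ^ u' * x ^ v'" "x ^ (2 * n + 2) = x * (x * x ^ u' * x ^ v')"
        by (simp_all add: s n power_add)
      show ?thesis unfolding g pw by algebra
    qed
  qed
  from arg_cong[OF this, of "\<lambda>y. qfact x (2 * n) * y"] show ?thesis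
    unfolding central_qbinom_def e q by (simp only: distrib_left mult_ac)
qed

text \<open>Induction on \<open>n\<close>. In the expanded new pair of factors, the term with
  \<open>a\<close> moves the summation index up and the term with \<open>b\<close> moves it down, by
  the shift lemmas; the rest keeps it. These are the three contributions in
  \<open>central_qbinom_Suc\<close>.\<close>

lemma finite_triple_product:
  assumes "norm (a * b) < 1"
  shows "(\<Prod>i<n. (1 - a * (a * b) ^ i) * (1 - b * (a * b) ^ i)) =
    (\<Sum>j=-int n..int n. theta_term a b j * central_qbinom (a * b) n j)"
proof (induction n)
  case 0
  show ?case by (simp add: theta_term_def tri_def central_qbinom_def inv_qfact_def)
next
  case (Suc n)
  define x where "x = a * b"
  let ?t = "theta_term a b" and ?C = "central_qbinom x"
  let ?I = "{-int n..int n}" and ?J = "{-int (Suc n)..int (Suc n)}"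
  have up: "(\<Sum>j\<in>?I. - (a * x ^ n) * ?t j * ?C n j) =
    (\<Sum>j\<in>?J. ?t j * (x ^ nat (int n - j + 1) * ?C n (j - 1)))"
  proof -
    have "(\<Sum>j\<in>?I. - (a * x ^ n) * ?t j * ?C n j) =
      (\<Sum>j\<in>?I. x ^ nat (int n - j) * ?t (j + 1) * ?C n j)"
      using theta_term_shift_up[of _ n a b] by (intro sum.cong) (auto simp: x_def)
    also have "\<dots> = (\<Sum>j=-int n+1..int n+1. ?t j * (x ^ nat (int n - j + 1) * ?C n (j - 1)))"
      by (intro sum.reindex_bij_witness[of _ "\<lambda>j. j - 1" "\<lambda>j. j + 1"]) (auto simp: algebra_simps)
    \<comment> \<open>Widening the range to \<open>?J\<close> adds only indices at which the
      binomial is 0.\<close>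
    also have "\<dots> = (\<Sum>j\<in>?J. ?t j * (x ^ nat (int n - j + 1) * ?C n (j - 1)))"
      by (intro sum.mono_neutral_left) (auto simp: central_qbinom_eq_0)
    finally show ?thesis .
  qed
  have down: "(\<Sum>j\<in>?I. - (b * x ^ n) * ?t j * ?C n j) =
    (\<Sum>j\<in>?J. ?t j * (x ^ nat (int n + j + 1) * ?C n (j + 1)))"
  proof -
    have "(\<Sum>j\<in>?I. - (b * x ^ n) * ?t j * ?C n j) =
      (\<Sum>j\<in>?I. x ^ nat (int n + j) * ?t (j - 1) * ?C n j)"
      using theta_term_shift_down[of _ n b a] by (intro sum.cong) (auto simp: x_def)
    also have "\<dots> = (\<Sum>j=-int n-1..int n-1. ?t j * (x ^ nat (int n + j + 1) * ?C n (j + 1)))"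
      by (intro sum.reindex_bij_witness[of _ "\<lambda>j. j + 1" "\<lambda>j. j - 1"]) (auto simp: algebra_simps)
    also have "\<dots> = (\<Sum>j\<in>?J. ?t j * (x ^ nat (int n + j + 1) * ?C n (j + 1)))"
      by (intro sum.mono_neutral_left) (auto simp: central_qbinom_eq_0)
    finally show ?thesis .
  qed
  have mid: "(\<Sum>j\<in>?I. (1 + x ^ (2 * n + 1)) * ?t j * ?C n j) =
    (\<Sum>j\<in>?J. ?t j * ((1 + x ^ (2 * n + 1)) * ?C n j))"
    by (intro sum.mono_neutral_cong_left) (auto simp: central_qbinom_eq_0)
  have fac: "(1 - a * x ^ n) * (1 - b * x ^ n) = 1 + x ^ (2 * n + 1) + - (a * x ^ n) + - (b * x ^ n)"
    by (simp add: x_def power_add mult_2 mult_2_right power_mult_distrib algebra_simps)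
  have "(\<Prod>i<Suc n. (1 - a * x ^ i) * (1 - b * x ^ i)) =
    (1 + x ^ (2 * n + 1) + - (a * x ^ n) + - (b * x ^ n)) * (\<Sum>j\<in>?I. ?t j * ?C n j)"
    by (subst prod.lessThan_Suc) (simp only: fac Suc.IH[folded x_def] mult.commute)
  also have "\<dots> = (\<Sum>j\<in>?I. (1 + x ^ (2 * n + 1)) * ?t j * ?C n j)
    + (\<Sum>j\<in>?I. - (a * x ^ n) * ?t j * ?C n j) + (\<Sum>j\<in>?I. - (b * x ^ n) * ?t j * ?C n j)"
    by (simp only: distrib_right sum_distrib_left mult.assoc sum.distrib)
  also have "\<dots> = (\<Sum>j\<in>?J. ?t j * ?C (Suc n) j)"
    unfolding up down mid sum.distrib[symmetric]
  proof (intro sum.cong refl, goal_cases)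
    case (1 j)
    then have "\<bar>j\<bar> \<le> int n + 1" by auto
    from central_qbinom_Suc[OF assms[folded x_def] this] show ?case
      by (simp only: distrib_left)
  qed
  finally show ?case unfolding x_def .
qed

section \<open>Passage to the infinite triple product\<close>

lemma qfact_limit:
  assumes "norm x < 1"
  shows "qfact x \<longlonglongrightarrow> qpoch_inf x x" "qpoch_inf x x \<noteq> 0"
proof -
  have p: "(\<lambda>i. 1 - x * x ^ i) has_prod qpoch_inf x x" by (rule qpoch_inf_has_prod[OF assms])
  show "qfact x \<longlonglongrightarrow> qpoch_inf x x"
    using has_prod_imp_tendsto'[OF p] by (simp add: qfact_def[abs_def])
  have "1 - x * x ^ i \<noteq> 0" for i
    using one_minus_power_nonzero[OF assms, of i] by simp
  then show "qpoch_inf x x \<noteq> 0"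
    using has_prod_eq_0_iff[OF p] by force
qed

lemma summable_power_nat_abs:
  assumes "0 \<le> r" "r < (1::real)"
  shows "(\<lambda>j::int. r ^ nat \<bar>j\<bar>) summable_on UNIV"
proof -
  have g: "(\<lambda>n::nat. r ^ n) summable_on UNIV"
    using assms by (intro norm_summable_imp_summable_on) (simp add: summable_geometric)
  have "(\<lambda>j::int. r ^ nat \<bar>j\<bar>) summable_on range int"
    by (subst summable_on_reindex) (use g in \<open>auto simp: o_def\<close>)
  moreover have "(\<lambda>j::int. r ^ nat \<bar>j\<bar>) summable_on range (\<lambda>n. - int n)"
    by (subst summable_on_reindex) (use g in \<open>auto simp: o_def inj_on_def\<close>)
  moreover have "(UNIV :: int set) = range int \<union> range (\<lambda>n. - int n)"
    by (auto simp: image_iff) (metis int_cases2)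
  ultimately show ?thesis by (metis summable_on_union)
qed

lemma norm_theta_term_le:
  assumes "norm a \<le> r" "norm b \<le> r" "r < 1"
  shows "norm (theta_term a b j) \<le> r ^ nat \<bar>j\<bar>"
proof -
  have r: "r \<ge> 0" using assms norm_ge_zero order_trans by blast
  have "int (tri j + tri (j - 1)) = j * j"
    using int_tri[of j] int_tri[of "j - 1"] by (simp add: algebra_simps)
  moreover have "\<bar>j\<bar> \<le> j * j"
    using mult_right_mono[of 1 "\<bar>j\<bar>" "\<bar>j\<bar>"] by (cases "j = 0") (auto simp: abs_mult_self_eq)
  ultimately have le: "nat \<bar>j\<bar> \<le> tri j + tri (j - 1)" by linarith
  have "norm (theta_term a b j) = norm a ^ tri j * norm b ^ tri (j - 1)"
    by (auto simp: theta_term_def norm_mult norm_power)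
  also have "\<dots> \<le> r ^ tri j * r ^ tri (j - 1)"
    using assms r by (intro mult_mono power_mono) auto
  also have "\<dots> \<le> r ^ nat \<bar>j\<bar>"
    unfolding power_add[symmetric] using le r assms by (intro power_decreasing) auto
  finally show ?thesis .
qed

text \<open>Convergent sequences are bounded, so the three factors have bounds that are uniform in
  \<open>n\<close> and \<open>j\<close>. This gives the dominating series for the limit of the
  finite identity.\<close>

lemma central_qbinom_bounded:
  assumes "norm x < 1"
  obtains B where "\<And>n j. norm (central_qbinom x n j) \<le> B"
proof -
  have "Bseq (qfact x)"
    using qfact_limit[OF assms] by (intro convergent_imp_Bseq convergentI)
  then obtain K where K: "\<And>n. norm (qfact x n) \<le> K" by (auto simp: Bseq_def)
  have "Bseq (\<lambda>n. 1 / qfact x n)"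
    using qfact_limit[OF assms] by (intro convergent_imp_Bseq convergentI[OF tendsto_divide]) auto
  then obtain L where "L > 0" and L: "\<And>n. norm (1 / qfact x n) \<le> L" by (auto simp: Bseq_def)
  have I: "norm (inv_qfact x m) \<le> L" for m
    using L[of "nat m"] \<open>L > 0\<close> by (auto simp: inv_qfact_def)
  have "K \<ge> 0" using K[of 0] norm_ge_zero order_trans by blast
  then have "norm (central_qbinom x n j) \<le> K * L * L" for n j
    unfolding central_qbinom_def norm_mult using K I \<open>L > 0\<close> by (intro mult_mono) auto
  then show thesis by (rule that)
qed

text \<open>\<open>qfact x (2 * n)\<close> tends to \<open>qpoch_inf x x\<close> and each of the two
  reciprocals to its inverse, so one inverse survives.\<close>

lemma central_qbinom_tendsto:
  assumes "norm x < 1"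
  shows "(\<lambda>n. central_qbinom x n j) \<longlonglongrightarrow> 1 / qpoch_inf x x"
proof -
  note q = qfact_limit[OF assms]
  have lim: "(\<lambda>n. inv_qfact x (int n + k)) \<longlonglongrightarrow> 1 / qpoch_inf x x" for k
  proof -
    have "filterlim (\<lambda>n. nat (int n + k)) at_top at_top"
      unfolding filterlim_at_top
    proof
      fix Z :: nat
      show "\<forall>\<^sub>F n in sequentially. Z \<le> nat (int n + k)"
        using eventually_ge_at_top[of "Z + nat \<bar>k\<bar>"] by eventually_elim linarith
    qed
    then have "(\<lambda>n. 1 / qfact x (nat (int n + k))) \<longlonglongrightarrow> 1 / qpoch_inf x x"
      using q by (intro tendsto_divide tendsto_const filterlim_compose[OF q(1)])
    moreover have "eventually (\<lambda>n. 1 / qfact x (nat (int n + k)) = inv_qfact x (int n + k)) at_top"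
      using eventually_ge_at_top[of "nat \<bar>k\<bar>"] by eventually_elim (auto simp: inv_qfact_def)
    ultimately show ?thesis by (rule Lim_transform_eventually)
  qed
  have "(\<lambda>n. qfact x (2 * n)) \<longlonglongrightarrow> qpoch_inf x x"
    by (rule filterlim_compose[OF q(1)]) (auto intro!: filterlim_subseq strict_monoI)
  from tendsto_mult[OF tendsto_mult[OF this lim[of "-j"]] lim[of j]] q(2)
  show ?thesis by (simp add: central_qbinom_def)
qed

text \<open>Tannery's theorem takes the limit of the finite form term by term, dominated by a
  geometric series in \<open>\<bar>j\<bar>\<close>. The factor \<open>1 / qpoch_inf x x\<close> that
  appears is then moved to the product side.\<close>

theorem jacobi_triple_product:
  assumes a: "norm a < 1" and b: "norm b < 1"
  shows "(theta_term a b has_sum qpoch_inf_list [a, b, a * b] (a * b)) UNIV"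
proof -
  define x where "x = a * b"
  define r where "r = max (norm a) (norm b)"
  have r: "0 \<le> r" "r < 1" "norm a \<le> r" "norm b \<le> r"
    using a b by (auto simp: r_def le_max_iff_disj)
  have x: "norm x < 1"
    using a b mult_le_one[of "norm a" "norm b"] mult_strict_mono[of "norm a" 1 "norm b" 1]
    by (simp add: x_def norm_mult)
  obtain B where B: "\<And>n j. norm (central_qbinom x n j) \<le> B"
    using central_qbinom_bounded[OF x] by blast
  \<comment> \<open>A bijection from the naturals to the integers turns the two-sided sum into the
    ordinary series to which Tannery's theorem applies.\<close>
  define d where "d = int_decode"
  have d: "bij d" unfolding d_def by (rule bij_int_decode)
  define f where "f k n = theta_term a b (d k) * central_qbinom x n (d k)" for k n
  define g where "g k = theta_term a b (d k) / qpoch_inf x x" for k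
  have sM: "summable (\<lambda>k. r ^ nat \<bar>d k\<bar> * B)"
  proof -
    have "(\<lambda>k. r ^ nat \<bar>d k\<bar>) summable_on UNIV"
      using summable_power_nat_abs[OF r(1,2)] summable_on_reindex_bij_betw[OF d, of "\<lambda>j. r ^ nat \<bar>j\<bar>"] by simp
    then show ?thesis by (intro summable_mult2 summable_on_imp_summable)
  qed
  have fs: "(\<Sum>k. f k n) = (\<Prod>i<n. (1 - a * x ^ i) * (1 - b * x ^ i))" for n
  proof -
    have "((\<lambda>j. theta_term a b j * central_qbinom x n j) has_sum
      (\<Sum>j=-int n..int n. theta_term a b j * central_qbinom x n j)) UNIV"
      by (rule has_sum_finite_neutralI[of "{-int n..int n}"]) (auto intro!: central_qbinom_eq_0)
    then have "((\<lambda>k. f k n) has_sum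
      (\<Sum>j=-int n..int n. theta_term a b j * central_qbinom x n j)) UNIV"
      unfolding f_def using has_sum_reindex_bij_betw[OF d] by fastforce
    from sums_unique[OF has_sum_imp_sums[OF this]] show ?thesis
      using finite_triple_product[of a b n] x unfolding x_def by simp
  qed
  have T: "eventually (\<lambda>n. summable (\<lambda>k. norm (f k n))) sequentially \<and> summable (\<lambda>n. norm (g n)) \<and>
    (\<lambda>n. \<Sum>k. f k n) \<longlonglongrightarrow> suminf g"
  proof (rule tannerys_theorem[OF _ _ sM])
    show "(\<lambda>n. f k n) \<longlonglongrightarrow> g k" for k
      using tendsto_mult[OF tendsto_const[of "theta_term a b (d k)"] central_qbinom_tendsto[OF x, of "d k"]]
      by (simp add: f_def g_def)
    have "norm (f k n) \<le> r ^ nat \<bar>d k\<bar> * B" for k n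
      unfolding f_def norm_mult using norm_theta_term_le[OF r(3,4,2)] B r by (intro mult_mono) auto
    then show "\<forall>\<^sub>F (k, n) in sequentially \<times>\<^sub>F sequentially. norm (f k n) \<le> r ^ nat \<bar>d k\<bar> * B"
      by (intro always_eventually) auto
  qed auto
  have "(\<lambda>n. \<Prod>i<n. (1 - a * x ^ i) * (1 - b * x ^ i)) \<longlonglongrightarrow> qpoch_inf a x * qpoch_inf b x"
    unfolding prod.distrib
    by (intro tendsto_mult has_prod_imp_tendsto' qpoch_inf_has_prod x)
  with T have "suminf g = qpoch_inf a x * qpoch_inf b x"
    unfolding fs using LIMSEQ_unique by blast
  then have "(g has_sum qpoch_inf a x * qpoch_inf b x) UNIV"
    using T by (intro norm_summable_imp_has_sum) (auto simp: summable_norm_cancel summable_sums_iff[symmetric] sums_iff)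
  from has_sum_cmult_right[OF this, of "qpoch_inf x x"]
  have "((\<lambda>k. theta_term a b (d k)) has_sum qpoch_inf_list [a, b, x] x) UNIV"
    using qfact_limit(2)[OF x] by (simp add: g_def qpoch_inf_list_def algebra_simps)
  then show ?thesis
    unfolding x_def using has_sum_reindex_bij_betw[OF d, of "theta_term a b"] by simp
qed

lemma theta_product_has_sum:
  assumes "norm q < 1" "0 < r" "0 < s"
  shows "((\<lambda>j. (if even j then 1 else -1) * q ^ (r * tri j + s * tri (j - 1))) has_sum
    qpoch_inf_list [q ^ r, q ^ s, q ^ (r + s)] (q ^ (r + s))) UNIV"
proof -
  have "norm (q ^ r) < 1" "norm (q ^ s) < 1"
    using assms by (auto simp: norm_power power_less_one_iff)
  from jacobi_triple_product[OF this] show ?thesis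
    by (simp add: theta_term_def[abs_def] power_add power_mult mult.assoc)
qed

section \<open>Regrouping products and double sums\<close>

lemma qpoch_inf_dissection:
  assumes q: "norm q < 1" and m: "0 < m"
  shows "(\<Prod>r<m. qpoch_inf (q ^ Suc r) (q ^ m)) = qpoch_inf q q"
proof -
  have qm: "norm (q ^ m) < 1" using q m by (simp add: norm_power power_less_one_iff)
  \<comment> \<open>The first \<open>n * m\<close> factors are cut into \<open>n\<close> blocks of
    length \<open>m\<close> and sorted by their position \<open>r\<close> in the block.\<close>
  have "(\<Prod>r<m. \<Prod>i<n. 1 - q ^ Suc r * (q ^ m) ^ i) = (\<Prod>i<n * m. 1 - q * q ^ i)" for n
  proof -
    have "(\<Prod>i<n * m. 1 - q * q ^ i) = (\<Prod>i<n. \<Prod>k=i*m..<i*m+m. 1 - q * q ^ k)"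
      by (rule prod.nat_group[symmetric])
    also have "\<dots> = (\<Prod>i<n. \<Prod>r<m. 1 - q ^ Suc r * (q ^ m) ^ i)"
    proof (rule prod.cong)
      fix i
      show "(\<Prod>k=i*m..<i*m+m. 1 - q * q ^ k) = (\<Prod>r<m. 1 - q ^ Suc r * (q ^ m) ^ i)"
        by (intro prod.reindex_bij_witness[of _ "\<lambda>r. i * m + r" "\<lambda>k. k - i * m"])
           (auto simp: power_add[symmetric] power_mult[symmetric] algebra_simps)
    qed simp
    also have "\<dots> = (\<Prod>r<m. \<Prod>i<n. 1 - q ^ Suc r * (q ^ m) ^ i)" by (rule prod.swap)
    finally show ?thesis ..
  qed
  moreover have "(\<lambda>n. \<Prod>r<m. \<Prod>i<n. 1 - q ^ Suc r * (q ^ m) ^ i) \<longlonglongrightarrow>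
      (\<Prod>r<m. qpoch_inf (q ^ Suc r) (q ^ m))"
    by (intro tendsto_prod has_prod_imp_tendsto' qpoch_inf_has_prod qm)
  moreover have "(\<lambda>n. \<Prod>i<n * m. 1 - q * q ^ i) \<longlonglongrightarrow> qpoch_inf q q"
    using m by (intro filterlim_compose[OF has_prod_imp_tendsto'[OF qpoch_inf_has_prod[OF q]]])
      (auto intro!: filterlim_subseq strict_monoI)
  ultimately show ?thesis using LIMSEQ_unique by simp
qed

text \<open>Summability of complex families is absolute, so the family of products is absolutely
  summable and the iterated sum is its sum.\<close>

lemma has_sum_product:
  fixes f :: "'a \<Rightarrow> complex" and g :: "'b \<Rightarrow> complex"
  assumes f: "(f has_sum a) A" and g: "(g has_sum b) B"
  shows "((\<lambda>(x, y). f x * g y) has_sum a * b) (A \<times> B)"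
proof (rule has_sum_SigmaI)
  show "((\<lambda>y. case (x, y) of (x, y) \<Rightarrow> f x * g y) has_sum f x * b) B" for x
    using has_sum_cmult_right[OF g] by simp
  show "((\<lambda>x. f x * b) has_sum a * b) A" by (rule has_sum_cmult_left[OF f])
  have f': "(\<lambda>x. norm (f x)) summable_on A" and g': "(\<lambda>y. norm (g y)) summable_on B"
    using f g has_sum_imp_summable summable_on_iff_abs_summable_on_complex by blast+
  then have "(\<lambda>x. norm (f x) * (\<Sum>\<^sub>\<infinity>y\<in>B. norm (g y))) summable_on A"
    "(\<lambda>y. norm (f x) * norm (g y)) summable_on B" for x
    by (auto intro: summable_on_cmult_left summable_on_cmult_right)
  then have "(\<lambda>z. norm ((\<lambda>(x, y). f x * g y) z)) summable_on A \<times> B"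
    using g'
    by (subst Infinite_Sum.abs_summable_on_Sigma_iff) (simp add: norm_mult infsum_cmult_right' abs_mult infsum_nonneg)
  then show "(\<lambda>(x, y). f x * g y) summable_on A \<times> B" by (rule abs_summable_summable)
qed

text \<open>Reindexing by the involution turns the sum \<open>S\<close> into
  \<open>- S\<close>.\<close>

lemma has_sum_0_sign_reversing_involution:
  fixes w :: "'a \<Rightarrow> complex"
  assumes "w summable_on M"
  assumes inv: "\<And>x. x \<in> M \<Longrightarrow> s x \<in> M \<and> s (s x) = x \<and> w (s x) = - w x"
  shows "(w has_sum 0) M"
proof -
  obtain S where S: "(w has_sum S) M" using assms(1) summable_on_def by blast
  have "((\<lambda>x. - w x) has_sum S) M \<longleftrightarrow> (w has_sum S) M"
    by (rule has_sum_reindex_bij_witness[of _ s s]) (use inv in auto)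
  with S has_sum_uminusI[OF S] have "S = - S" using has_sum_unique by blast
  then show ?thesis using S by simp
qed

subsection \<open>The two-dimensional sum\<close>

definition index_set :: "(int \<times> int) set" where
  "index_set = {(k, l). odd k \<and> odd l \<and> 3 dvd k - l \<and> k mod 5 = 3 \<and> (k mod 7 = 1 \<or> k mod 7 = 6)}"

text \<open>If \<open>k^2 = 840 m + 169\<close> and \<open>l^2 = 24 p + 1\<close>, this is
  \<open>m + p\<close>, because \<open>35 * 24 = 840\<close> and
  \<open>169 + 35 = 204\<close>.\<close>

definition expo :: "int \<Rightarrow> int \<Rightarrow> nat" where
  "expo k l = nat ((k\<^sup>2 + 35 * l\<^sup>2 - 204) div 840)"

text \<open>The two signs serve the two cancellations: the one modulo 7 changes under the exchange
  of \<open>l\<close> with \<open>c\<close>, the one modulo 4 under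
  \<open>l \<mapsto> -l\<close>.\<close>

definition weight :: "complex \<Rightarrow> int \<times> int \<Rightarrow> complex" where
  "weight q = (\<lambda>(k, l). (if k mod 7 = 6 then 1 else -1) * (if 4 dvd k - l then 1 else -1) * q ^ expo k l)"

lemma expo_eqI: "840 * int n = k\<^sup>2 + 35 * l\<^sup>2 - 204 \<Longrightarrow> expo k l = n"
  unfolding expo_def by (metis nat_int nonzero_mult_div_cancel_left zero_neq_numeral)

lemma weight_summable:
  assumes "norm q < 1"
  shows "weight q summable_on A"
proof -
  \<comment> \<open>The lower bound 1/2 keeps \<open>r\<close> positive, so that it has a positive
    840-th root \<open>s\<close> and division by powers of \<open>s\<close> is possible.\<close>
  define r where "r = max (norm q) (1 / 2)"
  have r: "0 < r" "r < 1" "norm q \<le> r" using assms by (auto simp: r_def)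
  define s where "s = root 840 r"
  have s: "0 < s" "s < 1" and rs: "r = s ^ 840" using r by (auto simp: s_def)
  have "norm (weight q (k, l)) \<le> s ^ nat \<bar>k\<bar> * s ^ nat \<bar>l\<bar> / s ^ 1043" for k l
  proof -
    have sq: "\<bar>y\<bar> \<le> y\<^sup>2" for y :: int
      using mult_right_mono[of 1 "\<bar>y\<bar>" "\<bar>y\<bar>"] by (cases "y = 0") (auto simp: power2_eq_square abs_mult_self_eq)
    have "y - 839 \<le> 840 * (y div 840)" for y :: int
      using pos_mod_bound[of 840 y] mult_div_mod_eq[of 840 y] by linarith
    from this[of "k\<^sup>2 + 35 * l\<^sup>2 - 204"]
    have "k\<^sup>2 + 35 * l\<^sup>2 - 204 - 839 \<le> 840 * ((k\<^sup>2 + 35 * l\<^sup>2 - 204) div 840)" .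
    moreover have "\<bar>k\<bar> + \<bar>l\<bar> \<le> k\<^sup>2 + 35 * l\<^sup>2" using sq[of k] sq[of l] by linarith
    \<comment> \<open>1043 is the constant 204 plus 839, the most that is lost by rounding in
      \<open>div 840\<close>. The weight is thus dominated by a product of two geometric
      series.\<close>
    ultimately have "nat \<bar>k\<bar> + nat \<bar>l\<bar> \<le> 840 * expo k l + 1043" unfolding expo_def by linarith
    then have "s ^ (840 * expo k l + 1043) \<le> s ^ (nat \<bar>k\<bar> + nat \<bar>l\<bar>)"
      using s by (intro power_decreasing) auto
    then have "r ^ expo k l \<le> s ^ nat \<bar>k\<bar> * s ^ nat \<bar>l\<bar> / s ^ 1043"
      using s by (simp add: rs power_add power_mult pos_le_divide_eq)
    moreover have "norm (weight q (k, l)) = norm q ^ expo k l"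
      by (simp add: weight_def norm_mult norm_power)
    ultimately show ?thesis using power_mono[OF r(3), of "expo k l"] by simp
  qed
  moreover obtain T where T: "((\<lambda>k::int. complex_of_real (s ^ nat \<bar>k\<bar>)) has_sum T) UNIV"
    using summable_on_of_real[OF summable_power_nat_abs[of s]] s summable_on_def by (metis less_le)
  have "(\<lambda>(k, l). complex_of_real (s ^ nat \<bar>k\<bar>) * complex_of_real (s ^ nat \<bar>l\<bar>))
      summable_on (UNIV \<times> UNIV :: (int \<times> int) set)"
    by (rule has_sum_imp_summable[OF has_sum_product[OF T T]])
  then have "(\<lambda>x. norm ((\<lambda>(k, l). complex_of_real (s ^ nat \<bar>k\<bar>) * complex_of_real (s ^ nat \<bar>l\<bar>)) x) / s ^ 1043)
      summable_on (UNIV :: (int \<times> int) set)"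
    using summable_on_iff_abs_summable_on_complex
    unfolding divide_inverse UNIV_Times_UNIV by (intro summable_on_cmult_left) blast
  ultimately have "(\<lambda>x. norm (weight q x)) summable_on UNIV"
    using s by (intro Infinite_Sum.abs_summable_on_comparison_test') (auto simp: norm_mult norm_power)
  then show ?thesis using abs_summable_summable summable_on_subset by blast
qed

text \<open>With \<open>k = l + 6 c\<close>, the number \<open>c\<close> is odd precisely because 4
  does not divide \<open>k - l\<close>, so exchanging \<open>l\<close> with \<open>c\<close> stays
  in the set. Modulo 5, \<open>k\<close> is \<open>l + c\<close>, which is kept; modulo 7 it is
  \<open>l - c\<close>, which is negated, and this reverses the sign.\<close>

lemma weight_sum_twisted:
  assumes "norm q < 1"
  shows "(weight q has_sum 0) {(k, l) \<in> index_set. \<not> 4 dvd k - l}" (is "(_ has_sum _) ?M")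
proof -
  have par: "\<exists>c. k = l + 6 * c \<and> odd c" if "(k, l) \<in> ?M" for k l
  proof -
    have "odd k" "odd l" "3 dvd k - l" "\<not> 4 dvd k - l" using that by (auto simp: index_set_def)
    moreover have "\<exists>c. d = 6 * c \<and> odd c" if "even d" "3 dvd d" "\<not> 4 dvd d" for d :: int
      using that by presburger
    ultimately obtain c where "k - l = 6 * c" "odd c" by (metis odd_even_add even_diff_iff)
    then have "k = l + 6 * c \<and> odd c" by simp
    then show ?thesis by blast
  qed
  have step: "((k + 35 * l) div 6, (k - l) div 6) \<in> ?M"
    "weight q ((k + 35 * l) div 6, (k - l) div 6) = - weight q (k, l)"
    "((k + 35 * l) div 6 + 35 * ((k - l) div 6)) div 6 = k"
    "((k + 35 * l) div 6 - (k - l) div 6) div 6 = l"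
    if kl: "(k, l) \<in> ?M" for k l
  proof -
    from par[OF kl] obtain c where c: "k = l + 6 * c" "odd c" by blast
    have odd: "odd l" and m: "k mod 5 = 3" "k mod 7 = 1 \<or> k mod 7 = 6"
      using kl by (auto simp: index_set_def)
    define k' where "k' = c + 6 * l"
    have "k + 35 * l = 6 * k'" "k - l = 6 * c" "k' + 35 * c = 6 * k" "k' - c = 6 * l"
      unfolding k'_def c(1) by simp_all
    then have e: "(k + 35 * l) div 6 = k'" "(k - l) div 6 = c" "(k' + 35 * c) div 6 = k" "(k' - c) div 6 = l"
      by simp_all
    have "\<not> 4 dvd 6 * d" "3 dvd 6 * d" if "odd d" for d :: int using that by presburger+
    then have n4: "\<not> 4 dvd k' - c" "\<not> 4 dvd k - l" "3 dvd k' - c"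
      using odd c(2) by (simp_all add: k'_def c(1))
    \<comment> \<open>The two congruences come from \<open>k' = k + 5 (l - c)\<close> and
      \<open>k' = - k + 7 (l + c)\<close>.\<close>
    have m5: "k' mod 5 = 3"
      using m(1) mod_mult_self2[of "l + 6 * c" 5 "l - c"] by (simp add: k'_def c(1) algebra_simps)
    have "k' mod 7 = (- k) mod 7"
      using mod_mult_self2[of "- (l + 6 * c)" 7 "l + c"] by (simp add: k'_def c(1) algebra_simps)
    moreover have "(- y) mod 7 = 6 \<longleftrightarrow> y mod 7 = 1" "(- y) mod 7 = 1 \<longleftrightarrow> y mod 7 = 6" for y :: int
      by presburger+
    ultimately have m7: "k' mod 7 = 6 \<longleftrightarrow> k mod 7 = 1" "k' mod 7 = 1 \<longleftrightarrow> k mod 7 = 6" by metis+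
    have "odd k'" using c(2) by (simp add: k'_def)
    then show "((k + 35 * l) div 6, (k - l) div 6) \<in> ?M"
      unfolding e using c(2) m(2) m5 m7 n4 by (auto simp: index_set_def)
    have "k'\<^sup>2 + 35 * c\<^sup>2 = k\<^sup>2 + 35 * l\<^sup>2"
      unfolding k'_def c(1) by (simp add: power2_eq_square algebra_simps)
    then have "expo k' c = expo k l" unfolding expo_def by simp
    then show "weight q ((k + 35 * l) div 6, (k - l) div 6) = - weight q (k, l)"
      unfolding e weight_def using m7 m(2) n4 by auto
    show "((k + 35 * l) div 6 + 35 * ((k - l) div 6)) div 6 = k"
      "((k + 35 * l) div 6 - (k - l) div 6) div 6 = l" unfolding e by simp_all
  qed
  show ?thesis
  proof (rule has_sum_0_sign_reversing_involution[where s = "\<lambda>(k, l). ((k + 35 * l) div 6, (k - l) div 6)"])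
    fix x assume x: "x \<in> ?M"
    obtain k l where kl: "x = (k, l)" by (cases x)
    show "(case x of (k, l) \<Rightarrow> ((k + 35 * l) div 6, (k - l) div 6)) \<in> ?M \<and>
      (case case x of (k, l) \<Rightarrow> ((k + 35 * l) div 6, (k - l) div 6) of
        (k, l) \<Rightarrow> ((k + 35 * l) div 6, (k - l) div 6)) = x \<and>
      weight q (case x of (k, l) \<Rightarrow> ((k + 35 * l) div 6, (k - l) div 6)) = - weight q x"
      using step[OF x[unfolded kl]] unfolding kl prod.case by blast
  qed (rule weight_summable[OF assms])
qed

text \<open>Here 3 divides both \<open>k\<close> and \<open>l\<close>, so
  \<open>l \<mapsto> -l\<close> respects the condition on \<open>k - l\<close>. For odd
  \<open>k\<close> and \<open>l\<close>, exactly one of \<open>k - l\<close> and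
  \<open>k + l\<close> is divisible by 4.\<close>

lemma weight_sum_3:
  assumes "norm q < 1"
  shows "(weight q has_sum 0) {(k, l) \<in> index_set. 3 dvd k}" (is "(_ has_sum _) ?M")
proof -
  have step: "(k, - l) \<in> ?M" "weight q (k, - l) = - weight q (k, l)" if kl: "(k, l) \<in> ?M" for k l
  proof -
    have m: "odd k" "odd l" "3 dvd k" "3 dvd k - l" using kl by (auto simp: index_set_def)
    have "3 dvd k + l" using m by presburger
    then show "(k, - l) \<in> ?M" using kl by (auto simp: index_set_def)
    have "4 dvd k + l \<longleftrightarrow> \<not> 4 dvd k - l" using m by presburger
    then show "weight q (k, - l) = - weight q (k, l)" by (simp add: weight_def expo_def)
  qed
  show ?thesis
    by (rule has_sum_0_sign_reversing_involution[where s = "\<lambda>(k, l). (k, - l)"])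
       (use step weight_summable[OF assms] in auto)
qed

lemma weight_sum_untwisted:
  assumes q: "norm q < 1"
  shows "(weight q has_sum
      qpoch_inf_list [q ^ 4, q, q ^ 5] (q ^ 5) * qpoch_inf_list [q ^ 4, q ^ 3, q ^ 7] (q ^ 7))
    {(k, l) \<in> index_set. 4 dvd k - l}" (is "(_ has_sum ?P) ?M")
proof -
  \<comment> \<open>In the coordinates \<open>x\<close>, \<open>y\<close> of the overview,
    \<open>x = 10 i + 3\<close> and \<open>y\<close> is \<open>14 j + 1\<close> or its negative; the
    parity of \<open>i + j\<close> selects the sign that makes \<open>l\<close> odd. It also decides
    between the residues 6 and 1 of \<open>k\<close> modulo 7, so the weight has the sign of the two
    theta series. The inverse \<open>g\<close> uses \<open>k + 5 l = 6 x\<close> and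
    \<open>k - 7 l = 6 y\<close>.\<close>
  define f where "f = (\<lambda>(i::int, j::int). if even (i + j) then (35 * (i + j) + 13, 5 * i - 7 * j + 1)
    else (35 * (i - j) + 8, 5 * i + 7 * j + 2))"
  define g where "g = (\<lambda>(k::int, l::int). if k mod 7 = 6 then ((k + 5 * l - 18) div 60, (k - 7 * l - 6) div 84)
    else ((k + 5 * l - 18) div 60, (7 * l - k - 6) div 84))"
  \<comment> \<open>The exponents are \<open>(5 i^2 + 3 i) / 2\<close> and
    \<open>(7 j^2 + j) / 2\<close>; their sum is
    \<open>(21 x^2 + 15 y^2 - 204) / 840\<close>.\<close>
  define h where "h = (\<lambda>(i, j). ((if even i then 1 else -1) * q ^ (4 * tri i + 1 * tri (i - 1))) *
      ((if even j then 1 else -1) * q ^ (4 * tri j + 3 * tri (j - 1))))"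
  have "(h has_sum ?P) UNIV"
    using has_sum_product[OF theta_product_has_sum[OF q, of 4 1] theta_product_has_sum[OF q, of 4 3]]
    by (simp add: h_def)
  also have "(h has_sum ?P) UNIV \<longleftrightarrow> (weight q has_sum ?P) ?M"
  proof (rule has_sum_reindex_bij_witness[of _ g f])
    fix x :: "int \<times> int"
    obtain i j where x: "x = (i, j)" by fastforce
    note t = int_tri[of i] int_tri[of "i - 1"] int_tri[of j] int_tri[of "j - 1"]
    let ?e = "4 * tri i + 1 * tri (i - 1) + (4 * tri j + 3 * tri (j - 1))"
    have *: "g (f x) = x \<and> f x \<in> ?M \<and> weight q (f x) = h x"
    proof (cases "even (i + j)")
      case True
      have fx: "f x = (35 * (i + j) + 13, 5 * i - 7 * j + 1)" using True by (simp add: f_def x)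
      have c: "(35 * (i + j) + 13) mod 7 = 6" "(35 * (i + j) + 13) mod 5 = 3" by presburger+
      have o: "odd (35 * (i + j) + 13)" "odd (5 * i - 7 * j + 1)" "3 dvd (35 * (i + j) + 13) - (5 * i - 7 * j + 1)"
        "4 dvd (35 * (i + j) + 13) - (5 * i - 7 * j + 1)" using True by presburger+
      have e: "expo (35 * (i + j) + 13) (5 * i - 7 * j + 1) = ?e"
        using t by (intro expo_eqI) (simp add: power2_eq_square algebra_simps)
      have "weight q (f x) = h x"
        unfolding fx weight_def using c o e True by (auto simp: h_def x power_add)
      moreover have "f x \<in> ?M" unfolding fx using c o by (auto simp: index_set_def)
      moreover have "g (f x) = x" unfolding fx g_def using c by (simp add: x algebra_simps)
      ultimately show ?thesis by blast
    next
      case False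
      have fx: "f x = (35 * (i - j) + 8, 5 * i + 7 * j + 2)" using False by (simp add: f_def x)
      have c: "(35 * (i - j) + 8) mod 7 = 1" "(35 * (i - j) + 8) mod 5 = 3" by presburger+
      have o: "odd (35 * (i - j) + 8)" "odd (5 * i + 7 * j + 2)" "3 dvd (35 * (i - j) + 8) - (5 * i + 7 * j + 2)"
        "4 dvd (35 * (i - j) + 8) - (5 * i + 7 * j + 2)" using False by presburger+
      have e: "expo (35 * (i - j) + 8) (5 * i + 7 * j + 2) = ?e"
        using t by (intro expo_eqI) (simp add: power2_eq_square algebra_simps)
      have "weight q (f x) = h x"
        unfolding fx weight_def using c o e False by (auto simp: h_def x power_add)
      moreover have "f x \<in> ?M" unfolding fx using c o by (auto simp: index_set_def)
      moreover have "g (f x) = x" unfolding fx g_def using c by (simp add: x algebra_simps)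
      ultimately show ?thesis by blast
    qed
    show "g (f x) = x" "f x \<in> ?M" "weight q (f x) = h x" using * by auto
  next
    fix y assume y: "y \<in> ?M"
    obtain k l where kl: "y = (k, l)" by fastforce
    have m: "odd k" "odd l" "3 dvd k - l" "k mod 5 = 3" "k mod 7 = 1 \<or> k mod 7 = 6" "4 dvd k - l"
      using y by (auto simp: index_set_def kl)
    have "12 dvd d" if "3 dvd d" "4 dvd d" for d :: int using that by presburger
    from this[OF m(3,6)] obtain c where "k - l = 12 * c" by (rule dvdE)
    then have c: "k = l + 12 * c" by simp
    \<comment> \<open>Now \<open>x = l + 2 c\<close> and \<open>y = 2 c - l\<close>. Since
      \<open>k = x + 10 c = 14 c - y\<close>, the residues of \<open>k\<close> modulo 5 and 7,
      together with oddness, fix \<open>x\<close> modulo 10 and \<open>y\<close> modulo 14 up to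
      sign.\<close>
    have "(l + 2 * c) mod 5 = 3"
      using m(4) mod_mult_self2[of "l + 2 * c" 5 "2 * c"] by (simp add: c algebra_simps)
    moreover have "odd (l + 2 * c)" using m(2) by simp
    moreover have "10 dvd x - 3" if "x mod 5 = 3" "odd x" for x :: int using that by presburger
    ultimately have "10 dvd l + 2 * c - 3" by blast
    then obtain i where "l + 2 * c - 3 = 10 * i" by (rule dvdE)
    then have i: "l + 2 * c = 10 * i + 3" by simp
    show "f (g y) = y"
    proof (cases "k mod 7 = 6")
      case True
      have "(- (2 * c - l)) mod 7 = 6"
        using True mod_mult_self2[of "l - 2 * c" 7 "2 * c"] by (simp add: c algebra_simps)
      moreover have "odd (2 * c - l)" using m(2) by simp
      moreover have "14 dvd x - 1" if "(- x) mod 7 = 6" "odd x" for x :: int using that by presburger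
      ultimately have "14 dvd 2 * c - l - 1" by blast
      then obtain j where "2 * c - l - 1 = 14 * j" by (rule dvdE)
      then have j: "2 * c - l = 14 * j + 1" by simp
      have l: "l = 5 * i - 7 * j + 1" and "12 * c = 30 * i + 42 * j + 12" using i j by linarith+
      then have k: "k = 35 * (i + j) + 13" by (simp add: c)
      have "even (i + j)" using m(2) l by presburger
      then show ?thesis unfolding kl g_def using True by (simp add: f_def k l algebra_simps)
    next
      case False
      have "(l - 2 * c) mod 7 = 1"
        using m(5) False mod_mult_self2[of "l - 2 * c" 7 "2 * c"] by (simp add: c algebra_simps)
      moreover have "odd (l - 2 * c)" using m(2) by simp
      moreover have "14 dvd x - 1" if "x mod 7 = 1" "odd x" for x :: int using that by presburger
      ultimately have "14 dvd l - 2 * c - 1" by blast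
      then obtain j where "l - 2 * c - 1 = 14 * j" by (rule dvdE)
      then have j: "l - 2 * c = 14 * j + 1" by simp
      have l: "l = 5 * i + 7 * j + 2" and "12 * c = 30 * i - 42 * j + 6" using i j by linarith+
      then have k: "k = 35 * (i - j) + 8" by (simp add: c)
      have "odd (i + j)" using m(2) l by presburger
      then show ?thesis unfolding kl g_def using False by (simp add: f_def k l algebra_simps)
    qed
  qed auto
  finally show ?thesis .
qed

subsection \<open>The square indices\<close>

text \<open>One class from each of the four pairs of opposite square roots of 169: the one that is 3
  modulo 5.\<close>

definition root_residues :: "int set" where
  "root_residues = {k. k mod 210 \<in> {13, 43, 83, 113}}"

text \<open>The part of the sign of \<open>weight\<close> that depends on \<open>k\<close> alone;
  the factor modulo 3 accounts for the sign of \<open>l = \<plusminus>(6 n + 1)\<close>.\<close>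

definition root_sign :: "int \<Rightarrow> complex" where
  "root_sign k = (if k mod 7 = 6 then 1 else -1) * (if k mod 4 = 1 then 1 else -1) * (if k mod 3 = 1 then 1 else -1)"

definition root_expo :: "int \<Rightarrow> nat" where
  "root_expo k = nat ((k\<^sup>2 - 169) div 840)"

text \<open>\<open>k^2 - r^2 = 420 c (105 c + r)\<close>, and \<open>c (105 c + r)\<close> is even
  because \<open>r\<close> is odd, so only the eight values of \<open>r\<close> need a check. Since
  \<open>\<bar>k\<bar> \<ge> 13\<close>, the conversion to \<open>nat\<close> loses nothing.\<close>

lemma root_expo:
  assumes "\<exists>c r. k = 210 * c + r \<and> r \<in> {13, 43, 83, 97, 113, 127, 167, 197}"
  shows "840 * int (root_expo k) = k\<^sup>2 - 169"
proof -
  obtain c r where k: "k = 210 * c + r" and r: "r \<in> {13, 43, 83, 97, 113, 127, 167, 197}"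
    using assms by blast
  have "even (c * (105 * c + r))" using r by auto
  then obtain e where "c * (105 * c + r) = 2 * e" by (rule evenE)
  then have "k\<^sup>2 - 169 = 840 * e + (r\<^sup>2 - 169)"
    unfolding k by (simp add: power2_eq_square algebra_simps)
  moreover have "840 dvd r\<^sup>2 - 169" using r by auto
  ultimately have d: "840 dvd k\<^sup>2 - 169" by (metis dvd_add dvd_triv_left)
  have "13 \<le> r" "r \<le> 197" using r by auto
  then have "\<bar>k\<bar> \<ge> 13" unfolding k by (cases "c \<ge> 0") linarith+
  then have "13\<^sup>2 \<le> \<bar>k\<bar>\<^sup>2" by (intro power_mono) auto
  then have "k\<^sup>2 - 169 \<ge> 0" by simp
  moreover from d obtain e' where e': "k\<^sup>2 - 169 = 840 * e'" by (rule dvdE)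
  ultimately have "e' \<ge> 0" by simp
  with e' show ?thesis by (simp add: root_expo_def)
qed

lemma root_residuesD:
  assumes "k \<in> root_residues"
  shows "odd k" "\<not> 3 dvd k" "k mod 5 = 3" "k mod 7 = 1 \<or> k mod 7 = 6"
    "840 * int (root_expo k) = k\<^sup>2 - 169"
proof -
  define c r where "c = k div 210" and "r = k mod 210"
  have k: "k = 210 * c + r" by (simp add: c_def r_def)
  have r: "r \<in> {13, 43, 83, 113}" using assms by (simp add: r_def root_residues_def)
  have m: "k mod 2 = r mod 2" "k mod 3 = r mod 3" "k mod 5 = r mod 5" "k mod 7 = r mod 7"
    by (simp_all add: r_def mod_mod_cancel)
  show "odd k" "\<not> 3 dvd k" "k mod 5 = 3" "k mod 7 = 1 \<or> k mod 7 = 6"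
    unfolding odd_iff_mod_2_eq_one dvd_eq_mod_eq_0 m using r by auto
  show "840 * int (root_expo k) = k\<^sup>2 - 169"
    using r by (intro root_expo exI[of _ c] exI[of _ r]) (auto simp flip: k)
qed

lemma root_residuesI:
  assumes "odd k" "\<not> 3 dvd k" "k mod 5 = 3" "k mod 7 = 1 \<or> k mod 7 = 6"
  shows "k \<in> root_residues"
proof -
  define r where "r = k mod 210"
  have m: "k mod 2 = r mod 2" "k mod 3 = r mod 3" "k mod 5 = r mod 5" "k mod 7 = r mod 7"
    by (simp_all add: r_def mod_mod_cancel)
  \<comment> \<open>Being odd and 3 modulo 5, \<open>r\<close> has last digit 3, which leaves 21
    candidates below 210.\<close>
  define u where "u = r div 10"
  have "odd r" "r mod 5 = 3" using m(1,3) assms(1,3) unfolding odd_iff_mod_2_eq_one by simp_all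
  then have "r mod 10 = 3" by presburger
  then have u: "r = 10 * u + 3" using mult_div_mod_eq[of 10 r] by (simp add: u_def)
  have "0 \<le> r" "r < 210" by (simp_all add: r_def)
  then have "0 \<le> u" "u \<le> 20" unfolding u by linarith+
  then have "u \<in> set [0..20]" by (simp del: upto_rec_numeral)
  then have "u \<in> {0, 1, 2, 3, 4, 5, 6, 7, 8, 9, 10, 11, 12, 13, 14, 15, 16, 17, 18, 19, 20}"
    by (simp add: upto_rec1)
  then have "r \<in> {13, 43, 83, 113}"
    using m(2,4) assms(2,4) unfolding u dvd_eq_mod_eq_0 by auto
  then show ?thesis by (simp add: r_def root_residues_def)
qed

text \<open>Modulo 5 the square is 4, so the root is 2 or 3; modulo 7 it is 1, so the root is 1 or
  6. A change of sign makes the residue modulo 5 equal to 3.\<close>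

lemma square_root_residues:
  assumes "(k::int)\<^sup>2 = 840 * m + 169"
  shows "k \<in> root_residues \<or> - k \<in> root_residues"
proof -
  have 2: "odd k"
  proof
    assume "even k"
    then have "even (k\<^sup>2)" by simp
    then show False unfolding assms by simp
  qed
  have 3: "\<not> 3 dvd k"
  proof
    assume "3 dvd k"
    then have "3 dvd k\<^sup>2" by (simp add: power2_eq_square)
    then show False unfolding assms using dvd_add_right_iff[of 3 "840 * m" 169] by simp
  qed
  have "(k mod 5)\<^sup>2 mod 5 = (840 * m + 169) mod 5" unfolding assms[symmetric] by (rule power_mod)
  then have "(k mod 5)\<^sup>2 mod 5 = 4" using mod_mult_self4[of 5 "168 * m" 169] by simp
  moreover have "k mod 5 \<in> set [0..4]" using pos_mod_bound[of 5 k] by simp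
  then have "k mod 5 \<in> {0, 1, 2, 3, 4}" by (simp add: upto_rec1)
  ultimately have 5: "k mod 5 = 3 \<or> k mod 5 = 2" by auto
  have "(k mod 7)\<^sup>2 mod 7 = (840 * m + 169) mod 7" unfolding assms[symmetric] by (rule power_mod)
  then have "(k mod 7)\<^sup>2 mod 7 = 1" using mod_mult_self4[of 7 "120 * m" 169] by simp
  moreover have "k mod 7 \<in> set [0..6]" using pos_mod_bound[of 7 k] by simp
  then have "k mod 7 \<in> {0, 1, 2, 3, 4, 5, 6}" by (simp add: upto_rec1)
  ultimately have 7: "k mod 7 = 1 \<or> k mod 7 = 6" by auto
  have "(- k) mod 7 = 1 \<or> (- k) mod 7 = 6" using 7 by presburger
  moreover have "(- k) mod 5 = 3" if "k mod 5 = 2" using that by presburger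
  ultimately show ?thesis using root_residuesI[of k] root_residuesI[of "- k"] 2 3 5 7 by auto
qed

text \<open>The sign \<open>\<sigma> k\<close> is chosen so that
  \<open>l = \<sigma> k * (6 n + 1)\<close> is congruent to \<open>k\<close> modulo 3; every
  admissible \<open>l\<close> arises from exactly one \<open>n\<close>. The exponent
  \<open>2 * tri n + tri (n - 1)\<close> is the pentagonal number \<open>(3 n^2 + n) / 2\<close>, so
  the sum over \<open>n\<close> is a triple product.\<close>

lemma weight_sum_factored:
  assumes q: "norm q < 1"
  assumes T: "((\<lambda>k. root_sign k * q ^ root_expo k) has_sum T) root_residues"
  shows "(weight q has_sum T * qpoch_inf_list [q\<^sup>2, q, q ^ 3] (q ^ 3)) {(k, l) \<in> index_set. \<not> 3 dvd k}"
    (is "(_ has_sum ?P) ?M")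
proof -
  define \<sigma> :: "int \<Rightarrow> int" where "\<sigma> k = (if k mod 3 = 1 then 1 else -1)" for k
  have \<sigma>: "\<sigma> k * (\<sigma> k * x) = x" "\<sigma> k = 1 \<or> \<sigma> k = -1" for k x by (auto simp: \<sigma>_def)
  define h where "h = (\<lambda>(k, n). (root_sign k * q ^ root_expo k) *
      ((if even n then 1 else -1) * q ^ (2 * tri n + 1 * tri (n - 1))))"
  have "(h has_sum ?P) (root_residues \<times> UNIV)"
    using has_sum_product[OF T theta_product_has_sum[OF q, of 2 1]] by (simp add: h_def)
  also have "(h has_sum ?P) (root_residues \<times> UNIV) \<longleftrightarrow> (weight q has_sum ?P) ?M"
  proof (rule has_sum_reindex_bij_witness[of _ "\<lambda>(k, l). (k, (\<sigma> k * l - 1) div 6)"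
        "\<lambda>(k, n). (k, \<sigma> k * (6 * n + 1))"])
    fix x assume "x \<in> root_residues \<times> (UNIV :: int set)"
    then obtain k n where x: "x = (k, n)" and k: "k \<in> root_residues" by auto
    note kD = root_residuesD[OF k]
    show "(case case x of (k, n) \<Rightarrow> (k, \<sigma> k * (6 * n + 1)) of (k, l) \<Rightarrow> (k, (\<sigma> k * l - 1) div 6)) = x"
      by (simp add: x \<sigma>)
    let ?l = "\<sigma> k * (6 * n + 1)"
    have "k mod 3 = 1 \<or> k mod 3 = 2" using kD(2) by presburger
    then have 3: "3 dvd k - ?l"
    proof
      assume m: "k mod 3 = 1"
      then have "3 dvd k - 1 - 3 * (2 * n)" by presburger
      then show ?thesis using m by (simp add: \<sigma>_def algebra_simps)
    next
      assume m: "k mod 3 = 2"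
      then have "3 dvd k + 1 + 3 * (2 * n)" by presburger
      then show ?thesis using m by (simp add: \<sigma>_def algebra_simps)
    qed
    have "odd ?l" using \<sigma>(2)[of k] by auto
    then show "(case x of (k, n) \<Rightarrow> (k, \<sigma> k * (6 * n + 1))) \<in> ?M"
      using kD 3 by (auto simp: x index_set_def)
    have l2: "?l\<^sup>2 = (6 * n + 1)\<^sup>2" using \<sigma>(2)[of k] by (auto simp: power_mult_distrib)
    have e: "expo k ?l = root_expo k + (2 * tri n + 1 * tri (n - 1))"
      unfolding expo_def l2
      using kD(5) int_tri[of n] int_tri[of "n - 1"]
      by (intro expo_eqI[unfolded expo_def]) (simp add: power2_eq_square algebra_simps)
    have 4: "4 dvd k - (6 * n + 1) \<longleftrightarrow> (k mod 4 = 1 \<longleftrightarrow> even n)"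
      "4 dvd k - - (6 * n + 1) \<longleftrightarrow> (k mod 4 = 1 \<longleftrightarrow> odd n)"
    proof -
      have "k mod 4 = 1 \<or> k mod 4 = 3" using kD(1) by presburger
      moreover have "(6 * n + 1) mod 4 = (if even n then 1 else 3)"
        "(- (6 * n + 1)) mod 4 = (if even n then 3 else 1)" by presburger+
      ultimately show "4 dvd k - (6 * n + 1) \<longleftrightarrow> (k mod 4 = 1 \<longleftrightarrow> even n)"
        "4 dvd k - - (6 * n + 1) \<longleftrightarrow> (k mod 4 = 1 \<longleftrightarrow> odd n)"
        unfolding mod_eq_dvd_iff[symmetric] by auto
    qed
    have "(if 4 dvd k - ?l then 1 else -1) =
      (if k mod 4 = 1 then 1 else -1) * (if k mod 3 = 1 then 1 else -1) * (if even n then 1 else - 1 :: complex)"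
    proof (cases "k mod 3 = 1")
      case True
      then have l: "?l = 6 * n + 1" by (simp add: \<sigma>_def)
      show ?thesis unfolding l using True 4(1) by (simp only: if_True) auto
    next
      case False
      then have l: "?l = - (6 * n + 1)" by (simp add: \<sigma>_def)
      show ?thesis unfolding l using False 4(2) by (simp only: if_False) auto
    qed
    then show "weight q (case x of (k, n) \<Rightarrow> (k, \<sigma> k * (6 * n + 1))) = h x"
      by (simp add: weight_def h_def x e root_sign_def power_add del: mult_1)
  next
    fix y assume "y \<in> ?M"
    then obtain k l where y: "y = (k, l)" and kl: "(k, l) \<in> index_set" "\<not> 3 dvd k" by auto
    have m: "odd k" "odd l" "3 dvd k - l" using kl by (auto simp: index_set_def)
    show "(case y of (k, l) \<Rightarrow> (k, (\<sigma> k * l - 1) div 6)) \<in> root_residues \<times> UNIV"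
      using kl root_residuesI[of k] by (auto simp: y index_set_def)
    have "l mod 3 = k mod 3" using m(3) by (metis mod_eq_dvd_iff)
    moreover have "k mod 3 = 1 \<or> k mod 3 = 2" using kl(2) by presburger
    moreover have "6 dvd l - 1" if "l mod 3 = 1" using m(2) that by presburger
    moreover have "6 dvd - l - 1" if "l mod 3 = 2" using m(2) that by presburger
    ultimately have "6 dvd \<sigma> k * l - 1" by (auto simp: \<sigma>_def)
    then have "6 * ((\<sigma> k * l - 1) div 6) + 1 = \<sigma> k * l" by simp
    then show "(case case y of (k, l) \<Rightarrow> (k, (\<sigma> k * l - 1) div 6) of (k, n) \<Rightarrow> (k, \<sigma> k * (6 * n + 1))) = y"
      by (simp add: y \<sigma>)
  qed auto
  finally show ?thesis .
qed

text \<open>The list consists of the residues modulo \<open>210\<close> whose squares are \<open>169\<close> modulo \<open>840\<close>.\<close>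

definition root_seq :: "nat \<Rightarrow> nat" where
  "root_seq n = 210 * (n div 8) + [13, 43, 83, 97, 113, 127, 167, 197] ! (n mod 8)"

lemma less_8_cases: "d < (8::nat) \<Longrightarrow> d \<in> {0, 1, 2, 3, 4, 5, 6, 7}"
proof -
  assume "d < 8"
  then have "d \<in> set [0..<8]" by simp
  also have "[0..<8] = [0, 1, 2, 3, 4, 5, 6, 7 :: nat]" by code_simp
  finally show ?thesis by simp
qed

lemma root_seq_mod: "root_seq n mod 210 \<in> {13, 43, 83, 97, 113, 127, 167, 197}"
proof -
  have "n mod 8 \<in> {0, 1, 2, 3, 4, 5, 6, 7}" by (rule less_8_cases) simp
  then show ?thesis unfolding root_seq_def by (elim insertE emptyE) simp_all
qed

lemma strict_mono_root_seq: "strict_mono root_seq"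
proof (rule strict_mono_Suc_iff[THEN iffD2], rule allI)
  fix n
  define c d :: nat where "c = n div 8" and "d = n mod 8"
  have n: "n = 8 * c + d" and d: "d \<in> {0, 1, 2, 3, 4, 5, 6, 7}"
    using less_8_cases[of d] by (simp_all add: c_def d_def)
  show "root_seq n < root_seq (Suc n)"
  \<comment> \<open>The case \<open>d = 7\<close> crosses into the next period, from 197 to 210 +
    13.\<close>
  proof (cases "d = 7")
    case True
    then have "Suc n = 8 * (c + 1)" by (simp add: n)
    then show ?thesis using True by (simp add: root_seq_def n)
  next
    case False
    then have "Suc d < 8" unfolding d_def by presburger
    then have "Suc n div 8 = c" "Suc n mod 8 = Suc d" by (simp_all add: n)
    moreover have "n div 8 = c" "n mod 8 = d" by (simp_all add: c_def d_def)
    ultimately show ?thesis using d False unfolding root_seq_def by (elim insertE emptyE) simp_all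
  qed
qed

lemma range_root_seq: "range root_seq = {k. k mod 210 \<in> {13, 43, 83, 97, 113, 127, 167, 197}}"
proof (intro equalityI subsetI)
  fix k assume k: "k \<in> {k::nat. k mod 210 \<in> {13, 43, 83, 97, 113, 127, 167, 197}}"
  then have "k mod 210 \<in> set [13, 43, 83, 97, 113, 127, 167, 197]" by simp
  then obtain d where "d < length [13, 43, 83, 97, 113, 127, 167, 197 :: nat]"
    and d2: "[13, 43, 83, 97, 113, 127, 167, 197] ! d = k mod 210"
    unfolding in_set_conv_nth by blast
  then have d: "d < 8" by simp
  have "root_seq (8 * (k div 210) + d) = k" using d by (simp add: root_seq_def d2)
  then show "k \<in> range root_seq" by (metis rangeI)
qed (use root_seq_mod in auto)

lemma root_seq_square: "(int (root_seq n))\<^sup>2 = 840 * int (root_expo (int (root_seq n))) + 169"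
proof -
  have "840 * int (root_expo (int (root_seq n))) = (int (root_seq n))\<^sup>2 - 169"
  proof (rule root_expo, intro exI conjI)
    show "int (root_seq n) = 210 * int (root_seq n div 210) + int (root_seq n mod 210)"
      by (metis mult_div_mod_eq of_nat_add of_nat_mult of_nat_numeral)
    show "int (root_seq n mod 210) \<in> {13, 43, 83, 97, 113, 127, 167, 197}"
      using imageI[OF root_seq_mod[of n], of int] by simp
  qed
  then show ?thesis by simp
qed

lemma square_root_in_range_root_seq:
  assumes "(int k)\<^sup>2 = 840 * m + 169"
  shows "k \<in> range root_seq"
proof -
  have "int k mod 210 \<in> {13, 43, 83, 97, 113, 127, 167, 197}"
    using square_root_residues[OF assms]
  proof
    assume "- int k \<in> root_residues"
    then have "(- int k) mod 210 \<in> {13, 43, 83, 113}" by (simp add: root_residues_def)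
    moreover have "int k mod 210 = (- ((- int k) mod 210)) mod 210" by (simp add: mod_minus_eq)
    ultimately show ?thesis by (elim insertE emptyE) simp_all
  qed (auto simp: root_residues_def)
  then have "int (k mod 210) \<in> int ` {13, 43, 83, 97, 113, 127, 167, 197}" by (simp add: of_nat_mod)
  then show ?thesis
    unfolding range_root_seq by (simp only: inj_image_mem_iff[OF inj_of_nat] mem_Collect_eq)
qed

lemma square_indices_eq: "square_indices = range (\<lambda>n. root_expo (int (root_seq n)))"
proof (intro equalityI subsetI)
  fix m assume "m \<in> square_indices"
  then obtain k where "840 * m + 169 = k\<^sup>2" by (auto simp: square_indices_def)
  then have "int (k\<^sup>2) = int (840 * m + 169)" by simp
  then have k: "(int k)\<^sup>2 = 840 * int m + 169" by simp
  then obtain n where "k = root_seq n" using square_root_in_range_root_seq by blast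
  then have "m = root_expo (int (root_seq n))" using k root_seq_square[of n] by simp
  then show "m \<in> range (\<lambda>n. root_expo (int (root_seq n)))" by blast
next
  fix m assume "m \<in> range (\<lambda>n. root_expo (int (root_seq n)))"
  then obtain n where "m = root_expo (int (root_seq n))" by blast
  then have "int (840 * m + 169) = int ((root_seq n)\<^sup>2)" using root_seq_square[of n] by simp
  then have "840 * m + 169 = (root_seq n)\<^sup>2" by (simp only: of_nat_eq_iff)
  then show "m \<in> square_indices" by (auto simp: square_indices_def)
qed

section \<open>The increasing enumeration and its signs\<close>

lemma enumerate_range_strict_mono:
  fixes f :: "nat \<Rightarrow> nat"
  assumes "strict_mono f"
  shows "enumerate (range f) n = f n"
proof (induction n)
  case 0
  have "(LEAST s. s \<in> range f) = f 0"
    by (rule Least_equality) (auto simp: strict_mono_less_eq[OF assms])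
  then show ?case by (simp add: enumerate_0)
next
  case (Suc n)
  have "infinite (range f)"
    using assms by (simp add: range_inj_infinite strict_mono_imp_inj_on)
  moreover have "(LEAST s. s \<in> range f \<and> f n < s) = f (Suc n)"
    by (rule Least_equality) (auto simp: strict_mono_less[OF assms] strict_mono_less_eq[OF assms])
  ultimately show ?case by (simp add: enumerate_Suc'' Suc.IH)
qed

lemma a_seq_eq: "a_seq n = root_expo (int (root_seq n))"
proof -
  have "strict_mono (\<lambda>n. root_expo (int (root_seq n)))"
  proof (rule strict_monoI)
    fix m n :: nat assume "m < n"
    then have "root_seq m < root_seq n" using strict_mono_root_seq by (simp add: strict_mono_less)
    then have "(int (root_seq m))\<^sup>2 < (int (root_seq n))\<^sup>2" by (intro power_strict_mono) auto
    then show "root_expo (int (root_seq m)) < root_expo (int (root_seq n))"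
      unfolding root_seq_square by simp
  qed
  then show ?thesis unfolding a_seq_def square_indices_eq by (rule enumerate_range_strict_mono)
qed

text \<open>Each pair of opposite square roots has exactly one member that is \<open>3\<close> modulo \<open>5\<close>.\<close>

definition signed_root :: "nat \<Rightarrow> int" where
  "signed_root n = (if root_seq n mod 5 = 3 then int (root_seq n) else - int (root_seq n))"

lemma abs_signed_root: "\<bar>signed_root n\<bar> = int (root_seq n)"
  by (simp add: signed_root_def)

text \<open>The absolute value recovers the positive root, which gives injectivity. For
  surjectivity, \<open>k\<close> and \<open>-k\<close> cannot both be 3 modulo 5.\<close>

lemma bij_signed_root: "bij_betw signed_root UNIV root_residues"
proof (rule bij_betw_imageI)
  show "inj signed_root"
  proof
    fix m n assume "signed_root m = signed_root n"
    then have "root_seq m = root_seq n" using abs_signed_root[of m] abs_signed_root[of n] by simp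
    then show "m = n" using strict_mono_root_seq by (simp add: strict_mono_eq)
  qed
  have neg: "(- x) mod 5 = 3 \<Longrightarrow> x mod 5 \<noteq> 3" for x :: int by presburger
  have 5: "root_seq n mod 5 = 3 \<longleftrightarrow> int (root_seq n) mod 5 = 3" for n by presburger
  have mem: "signed_root n \<in> root_residues" for n
    using square_root_residues[OF root_seq_square[of n]] root_residuesD(3)[of "int (root_seq n)"]
      root_residuesD(3)[of "- int (root_seq n)"] neg[of "int (root_seq n)"] 5[of n]
    by (auto simp: signed_root_def)
  show "range signed_root = root_residues"
  proof (intro equalityI subsetI)
    fix k assume k: "k \<in> root_residues"
    have "(int (nat \<bar>k\<bar>))\<^sup>2 = 840 * int (root_expo k) + 169" using root_residuesD(5)[OF k] by simp
    from square_root_in_range_root_seq[OF this] obtain n where n: "nat \<bar>k\<bar> = root_seq n" by blast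
    then have "\<bar>k\<bar> = \<bar>signed_root n\<bar>" unfolding abs_signed_root by linarith
    moreover have "k mod 5 = 3" "signed_root n mod 5 = 3" using root_residuesD(3) k mem by auto
    ultimately have "k = signed_root n" using neg[of "signed_root n"] by (auto simp: abs_eq_iff)
    then show "k \<in> range signed_root" by blast
  qed (use mem in auto)
qed

text \<open>\<open>root_sign\<close> has period 84, and sixteen steps of \<open>root_seq\<close> add
  420, a multiple of both 84 and 5. Hence the pattern modulo 16, which is checked on its first
  sixteen values.\<close>

lemma root_sign_signed_root: "root_sign (signed_root n) = (-1) ^ t_exp n"
proof -
  define c d where "c = n div 16" and "d = n mod 16"
  have n: "n = 16 * c + d" and "d < 16" by (simp_all add: c_def d_def)
  then have "d \<in> set [0..<16]" by simp
  also have "[0..<16] = [0, 1, 2, 3, 4, 5, 6, 7, 8, 9, 10, 11, 12, 13, 14, 15 :: nat]" by code_simp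
  finally have d: "d \<in> {0, 1, 2, 3, 4, 5, 6, 7, 8, 9, 10, 11, 12, 13, 14, 15}" by simp
  have "n div 8 = 2 * c + d div 8" "n mod 8 = d mod 8" unfolding n by presburger+
  then have r: "root_seq n = 420 * c + root_seq d" by (simp add: root_seq_def)
  have m5: "root_seq n mod 5 = root_seq d mod 5"
    unfolding r using mod_mult_self4[of 5 "84 * c" "root_seq d"] by simp
  \<comment> \<open>The shift by 420 is negated together with the root.\<close>
  define b where "b = (if root_seq d mod 5 = 3 then int c else - int c)"
  have b: "signed_root n = 420 * b + signed_root d"
    unfolding signed_root_def m5 b_def by (simp add: r)
  have "root_sign (420 * b + x) = root_sign x" for x
    using mod_mult_self4[of 7 "60 * b" x] mod_mult_self4[of 4 "105 * b" x] mod_mult_self4[of 3 "140 * b" x]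
    by (simp add: root_sign_def)
  then have "root_sign (signed_root n) = root_sign (signed_root d)" by (simp add: b)
  also have "\<dots> = (-1) ^ t_exp d"
    using d by (elim insertE emptyE) (simp_all add: root_sign_def signed_root_def root_seq_def t_exp_def)
  also have "t_exp d = t_exp n" by (simp add: t_exp_def d_def)
  finally show ?thesis .
qed

section \<open>Comparing the two evaluations of the double sum\<close>

theorem theorem6:
  fixes q :: complex
  assumes "norm q < 1"
  shows "(\<lambda>n. (-1) ^ t_exp n * q ^ a_seq n) sums
           (qpoch_inf_list [q ^ 3, q ^ 4, q ^ 7] (q ^ 7) / qpoch_inf_list [q ^ 2, q ^ 3] (q ^ 5))"
proof -
  let ?f = "\<lambda>n. (-1) ^ t_exp n * q ^ a_seq n"
  \<comment> \<open>An increasing enumeration of naturals satisfies \<open>a_seq n \<ge> n\<close>,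
    so a geometric series dominates.\<close>
  have "a_seq n \<ge> n" for n
    unfolding a_seq_def by (rule le_enumerate[OF infinite_square_indices])
  then have "norm (?f n) \<le> norm q ^ n" for n
    using assms by (simp add: norm_mult norm_power power_decreasing)
  then have "summable (\<lambda>n. norm (?f n))"
    using assms by (intro summable_comparison_test'[OF summable_geometric[of "norm q"]]) auto
  define T where "T = infsum ?f UNIV"
  have T: "(?f has_sum T) UNIV"
    unfolding T_def by (rule has_sum_infsum[OF norm_summable_imp_summable_on]) fact
  have "root_expo (signed_root n) = a_seq n" for n
    by (simp add: a_seq_eq signed_root_def root_expo_def)
  then have "((\<lambda>k. root_sign k * q ^ root_expo k) has_sum T) root_residues"
    using T has_sum_reindex_bij_betw[OF bij_signed_root, of "\<lambda>k. root_sign k * q ^ root_expo k"]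
    by (simp add: root_sign_signed_root)
  note fac = weight_sum_factored[OF assms this]
  let ?P5 = "qpoch_inf_list [q ^ 4, q, q ^ 5] (q ^ 5)" and ?P7 = "qpoch_inf_list [q ^ 4, q ^ 3, q ^ 7] (q ^ 7)"
  let ?P3 = "qpoch_inf_list [q\<^sup>2, q, q ^ 3] (q ^ 3)"
  \<comment> \<open>The sum over \<open>index_set\<close> is evaluated twice: split by divisibility
    of \<open>k - l\<close> by 4, and split by divisibility of \<open>k\<close> by 3. In each
    splitting one part sums to 0.\<close>
  have "(weight q has_sum (?P5 * ?P7 + 0))
      ({(k, l) \<in> index_set. 4 dvd k - l} \<union> {(k, l) \<in> index_set. \<not> 4 dvd k - l})"
    by (intro has_sum_Un_disjoint weight_sum_untwisted weight_sum_twisted assms) auto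
  also have "{(k, l) \<in> index_set. 4 dvd k - l} \<union> {(k, l) \<in> index_set. \<not> 4 dvd k - l} =
      {(k, l) \<in> index_set. \<not> 3 dvd k} \<union> {(k, l) \<in> index_set. 3 dvd k}" by auto
  finally have "(weight q has_sum (?P5 * ?P7 + 0))
      ({(k, l) \<in> index_set. \<not> 3 dvd k} \<union> {(k, l) \<in> index_set. 3 dvd k})" .
  moreover have "(weight q has_sum (T * ?P3 + 0))
      ({(k, l) \<in> index_set. \<not> 3 dvd k} \<union> {(k, l) \<in> index_set. 3 dvd k})"
    by (intro has_sum_Un_disjoint weight_sum_3 fac assms) auto
  ultimately have "?P5 * ?P7 + 0 = T * ?P3 + 0" by (rule has_sum_unique)
  then have eq: "?P5 * ?P7 = T * ?P3" by simp
  have "{..<3::nat} = {0, 1, 2}" "{..<5::nat} = {0, 1, 2, 3, 4}"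
    by (simp_all add: lessThan_nat_numeral lessThan_Suc insert_commute)
  note sets = this
  \<comment> \<open>The three classes modulo 3 exhaust \<open>(q; q)\<close>, whereas
    \<open>?P5\<close> lacks the classes 2 and 3 modulo 5, which are the denominator of the
    claim.\<close>
  have P3: "?P3 = qpoch_inf q q"
    using qpoch_inf_dissection[OF assms, of 3] by (simp add: qpoch_inf_list_def sets mult_ac numeral_2_eq_2[symmetric] del: power_Suc)
  have P5: "?P5 * qpoch_inf_list [q ^ 2, q ^ 3] (q ^ 5) = qpoch_inf q q"
    using qpoch_inf_dissection[OF assms, of 5] by (simp add: qpoch_inf_list_def sets mult_ac numeral_2_eq_2[symmetric] del: power_Suc)
  have nz: "qpoch_inf q q \<noteq> 0" by (rule qfact_limit(2)[OF assms])
  \<comment> \<open>Both sides contain \<open>?P5\<close>, which is nonzero as a factor of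
    \<open>qpoch_inf q q\<close> and cancels.\<close>
  have "?P5 * ?P7 = ?P5 * (T * qpoch_inf_list [q ^ 2, q ^ 3] (q ^ 5))"
    unfolding eq P3 P5[symmetric] by (simp only: mult_ac)
  moreover have "?P5 \<noteq> 0" "qpoch_inf_list [q ^ 2, q ^ 3] (q ^ 5) \<noteq> 0"
    using P5 nz by (metis mult_zero_left, metis mult_zero_right)
  ultimately have "T = ?P7 / qpoch_inf_list [q ^ 2, q ^ 3] (q ^ 5)"
    by (simp add: eq_divide_eq)
  also have "?P7 = qpoch_inf_list [q ^ 3, q ^ 4, q ^ 7] (q ^ 7)" by (simp add: qpoch_inf_list_def)
  finally show ?thesis using has_sum_imp_sums[OF T] by simp
qed

end
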